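(* Let $\sigma\in S_n$ have cycle decomposition $\sigma=\sigma_1\cdots\sigma_m$ (fixed points included as $1$-cycles, each cycle identified with its set of elements), and label the facets of $\mathrm{SEP}(K_n)$ by nonempty proper subsets of $[n]$, the facet labeled $S$ being $\mathrm{SEP}(K_n)\cap\{\mathbf{x}:\mathbf{e}_S^\top\mathbf{x}=1\}$. Then $\mathrm{SEP}(K_n)^\sigma$ has exactly $2^m-2$ facets, and each facet of $\mathrm{SEP}(K_n)^\sigma$ is contained in a distinct facet of $\mathrm{SEP}(K_n)$ whose label $S$ satisfies, for each $k\in[m]$, either $S\cap\sigma_k=\emptyset$ or $S\cap\sigma_k=\sigma_k$.
   Context: $\mathrm{SEP}(K_n)=\operatorname{conv}\{\mathbf{e}_i-\mathbf{e}_j\in\mathbb{R}^n:i\neq j\}$ is an $(n-1)$-dimensional polytope in $\{\mathbf{x}:\mathbf{1}^\top\mathbf{x}=0\}$ whose facets are exactly the $2^n-2$ faces $\mathrm{SEP}(K_n)\cap\{\mathbf{e}_S^\top\mathbf{x}=1\}$ for nonempty proper $S\subset[n]$; $\mathbf{e}_S=\sum_{i\in S}\mathbf{e}_i$, $\mathbf{1}=\mathbf{e}_{[n]}$. $S_n$ acts on $\mathbb{R}^n$ by $\sigma\cdot\mathbf{e}_i=\mathbf{e}_{\sigma(i)}$ and $P^\sigma=\{\mathbf{x}\in P:\sigma\cdot\mathbf{x}=\mathbf{x}\}$. *)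

theory Defs
  imports "HOL-Analysis.Analysis" "HOL-Combinatorics.Cycles"
begin

text \<open>The ground set \<open>[n]\<close> is the finite index type \<^typ>\<open>'n\<close>, with \<open>n = CARD('n)\<close>.\<close>

definition indicator_vec :: "'n set \<Rightarrow> real ^ 'n::finite" where
  "indicator_vec S = (\<Sum>i\<in>S. axis i 1)"

definition SEP :: "(real ^ 'n::finite) set" where
  "SEP = convex hull {axis i 1 - axis j 1 | i j. i \<noteq> j}"

definition SEP_facet :: "'n set \<Rightarrow> (real ^ 'n::finite) set" where
  "SEP_facet S = SEP \<inter> {x. indicator_vec S \<bullet> x = 1}"

text \<open>The linear extension of \<open>e\<^sub>i \<mapsto> e\<^bsub>\<sigma>(i)\<^esub>\<close>.\<close>

definition perm_act :: "('n \<Rightarrow> 'n) \<Rightarrow> real ^ 'n::finite \<Rightarrow> real ^ 'n" where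
  "perm_act \<sigma> x = (\<Sum>i\<in>UNIV. x $ i *\<^sub>R axis (\<sigma> i) 1)"

definition fixed_part :: "('n \<Rightarrow> 'n) \<Rightarrow> (real ^ 'n::finite) set \<Rightarrow> (real ^ 'n) set" where
  "fixed_part \<sigma> P = {x \<in> P. perm_act \<sigma> x = x}"

text \<open>The list \<open>cs\<close> enumerates the cycles; those of length 1 are the fixed points, which must
  all be listed since the cycles cover the whole index type. Distinctness of the concatenation
  says that every cycle is repetition-free and that the cycles are pairwise disjoint.\<close>

definition is_cycle_decomposition :: "('n \<Rightarrow> 'n) \<Rightarrow> 'n list list \<Rightarrow> bool" where
  "is_cycle_decomposition \<sigma> cs \<longleftrightarrow>
     (\<forall>c\<in>set cs. c \<noteq> []) \<and> distinct (concat cs) \<and> set (concat cs) = UNIV \<and>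
     \<sigma> = foldr (\<circ>) (map cycle_of_list cs) id"

lemma ex_cycle_decomposition:
  fixes \<sigma> :: "'n::finite \<Rightarrow> 'n"
  assumes "\<sigma> permutes UNIV"
  shows "\<exists>cs. is_cycle_decomposition \<sigma> cs"
proof -
  have "\<exists>cs. (\<forall>c\<in>set cs. c \<noteq> []) \<and> distinct (concat cs) \<and> set (concat cs) = I \<and>
          p = foldr (\<circ>) (map cycle_of_list cs) id" if "cycle_decomp I p" for I and p :: "'n \<Rightarrow> 'n"
    using that
  proof (induction rule: cycle_decomp.induct)
    case empty
    show ?case by (rule exI[of _ "[]"]) simp
  next
    case (comp I p c)
    then obtain cs where cs: "\<forall>c\<in>set cs. c \<noteq> []" "distinct (concat cs)" "set (concat cs) = I"
      "p = foldr (\<circ>) (map cycle_of_list cs) id" by blast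
    show ?case
    proof (cases "c = []")
      case True
      then have "set c \<union> I = I" and "cycle_of_list c \<circ> p = p" by simp_all
      with cs show ?thesis by metis
    next
      case False
      with cs comp.hyps
      have "(\<forall>c\<in>set (c # cs). c \<noteq> []) \<and> distinct (concat (c # cs)) \<and>
            set (concat (c # cs)) = set c \<union> I"
        by auto
      moreover have "cycle_of_list c \<circ> p = foldr (\<circ>) (map cycle_of_list (c # cs)) id"
        unfolding cs(4) by (simp only: list.map foldr_Cons comp_apply)
      ultimately show ?thesis by blast
    qed
  qed
  from this[OF cycle_decomposition[OF assms]] show ?thesis
    by (simp add: is_cycle_decomposition_def)
qed

end

theory Submission
  imports Defs
begin

text \<open>For \<open>n \<ge> 2\<close>, a point \<open>x\<close> with coordinate sum \<open>0\<close> lies in \<open>SEP\<close> iff its positive entries sum to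
  at most \<open>1\<close>, and the set of positive entries of a \<open>\<sigma>\<close>-fixed point is \<open>\<sigma>\<close>-invariant. So the fixed
  polytope is cut out of the space of fixed vectors with sum \<open>0\<close> by the inequalities
  \<open>e\<^sub>S \<bullet> x \<le> 1\<close> for the invariant nonempty proper sets \<open>S\<close>. Each of them is irredundant: a slight
  dilation of the difference of the barycentres of \<open>S\<close> and of its complement violates this
  inequality only. Hence the facets correspond to the invariant nonempty proper sets, which are
  the unions of cycles, and \<open>\<sigma> = id\<close> gives the facets of \<open>SEP\<close> itself. For \<open>n = 1\<close> the polytope is
  empty and \<open>m = 1\<close>.\<close>

section \<open>Coordinate forms of the inequalities and of the permutation action\<close>

lemma inner_indicator_vec: "indicator_vec S \<bullet> x = (\<Sum>i\<in>S. x $ i)"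
  unfolding indicator_vec_def by (simp add: inner_sum_left inner_axis')

lemma indicator_vec_eq_0_iff: "indicator_vec S = 0 \<longleftrightarrow> S = {}"
proof
  assume "indicator_vec S = 0"
  then have "real (card S) = 0"
    using inner_indicator_vec[of S "\<chi> i. 1"] by simp
  then show "S = {}" by simp
qed (simp add: indicator_vec_def)

lemma perm_act_eq_iff:
  fixes x :: "real ^ 'n::finite"
  assumes "\<sigma> permutes UNIV"
  shows "perm_act \<sigma> x = x \<longleftrightarrow> (\<forall>i. x $ \<sigma> i = x $ i)"
proof -
  have inj: "inj \<sigma>" and surj: "surj \<sigma>"
    using assms by (auto simp: permutes_inj permutes_surj)
  have "perm_act \<sigma> x $ \<sigma> i = x $ i" for i
    by (simp add: perm_act_def axis_def inj_eq[OF inj] if_distrib cong: if_cong)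
  then show ?thesis
    by (metis surj surjD vec_eq_iff)
qed

subsection \<open>The inequalities of the symmetric edge polytope\<close>

text \<open>On a generator the sum over \<open>S\<close> is -1, 0 or 1, and a half-space is
  convex.\<close>

lemma SEP_sum_le_1:
  assumes "x \<in> SEP"
  shows "(\<Sum>i\<in>S. x $ i) \<le> 1"
proof -
  have "convex hull {axis i 1 - axis j 1 | i j. i \<noteq> j} \<subseteq> {x. indicator_vec S \<bullet> x \<le> 1}"
    by (intro hull_minimal convex_halfspace_le)
       (auto simp: inner_indicator_vec sum_subtractf axis_def)
  with assms show ?thesis
    by (auto simp: SEP_def inner_indicator_vec)
qed

lemma SEP_sum_eq_0:
  assumes "x \<in> SEP"
  shows "(\<Sum>i\<in>UNIV. x $ i) = 0"
proof -
  have "convex hull {axis i 1 - axis j 1 | i j. i \<noteq> j} \<subseteq> {x. indicator_vec UNIV \<bullet> x = 0}"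
    by (intro hull_minimal convex_hyperplane)
       (auto simp: inner_indicator_vec sum_subtractf axis_def)
  with assms show ?thesis
    by (auto simp: SEP_def inner_indicator_vec)
qed

lemma convex_SEP: "convex SEP"
  by (simp add: SEP_def)

lemma axis_diff_in_SEP: "i \<noteq> j \<Longrightarrow> axis i 1 - axis j 1 \<in> SEP"
  unfolding SEP_def by (rule hull_inc) blast

lemma zero_in_SEP:
  assumes "CARD('n::finite) \<ge> 2"
  shows "(0 :: real ^ 'n) \<in> SEP"
proof -
  obtain i j :: 'n where ij: "i \<noteq> j"
    using assms card_le_Suc0_iff_eq[of "UNIV :: 'n set"] by fastforce
  have "(1/2) *\<^sub>R (axis i 1 - axis j 1) + (1/2) *\<^sub>R (axis j 1 - axis i 1) \<in> (SEP :: (real ^ 'n) set)"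
    by (rule convexD[OF convex_SEP]) (use ij in \<open>auto intro: axis_diff_in_SEP\<close>)
  then show ?thesis
    by (simp add: algebra_simps)
qed

lemma sum_pos_neg:
  fixes x :: "real ^ 'n::finite"
  assumes "(\<Sum>i\<in>UNIV. x $ i) = 0"
  shows "(\<Sum>j | x $ j < 0. - x $ j) = (\<Sum>i | x $ i > 0. x $ i)"
proof -
  have "(\<Sum>i\<in>UNIV. x $ i) = (\<Sum>i | x $ i > 0. x $ i) + (\<Sum>i | x $ i < 0. x $ i)"
    by (subst sum.union_disjoint[symmetric]) (auto intro!: sum.mono_neutral_right)
  with assms show ?thesis
    by (simp add: sum_negf)
qed

text \<open>With \<open>s\<close> the sum of the positive entries, \<open>x / s\<close> is the convex combination of the
  \<open>e\<^sub>i - e\<^sub>j\<close> with the product weights \<open>x\<^sub>i \<bar>x\<^sub>j\<bar> / s\<^sup>2\<close> over \<open>x\<^sub>i > 0 > x\<^sub>j\<close>.\<close>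

lemma in_SEP_if_sum_pos_le_1:
  fixes x :: "real ^ 'n::finite"
  assumes card: "CARD('n) \<ge> 2"
    and sum0: "(\<Sum>i\<in>UNIV. x $ i) = 0"
    and le1: "(\<Sum>i | x $ i > 0. x $ i) \<le> 1"
  shows "x \<in> SEP"
proof -
  define P where "P = {i. x $ i > 0}"
  define N where "N = {j. x $ j < 0}"
  define s where "s = (\<Sum>i\<in>P. x $ i)"
  have sN: "(\<Sum>j\<in>N. - x $ j) = s"
    using sum_pos_neg[OF sum0] by (simp add: P_def N_def s_def)
  have decomp: "x = (\<Sum>i\<in>P. x $ i *\<^sub>R axis i 1) - (\<Sum>j\<in>N. (- x $ j) *\<^sub>R axis j 1)"
    by (auto simp: vec_eq_iff P_def N_def axis_def if_distrib cong: if_cong)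
  show ?thesis
  proof (cases "P = {}")
    case True
    have "N = {}"
    proof (rule ccontr)
      assume "N \<noteq> {}"
      then have "(\<Sum>j\<in>N. - x $ j) > 0"
        by (intro sum_pos) (auto simp: N_def)
      with sN True show False by (simp add: s_def)
    qed
    with True decomp have "x = 0" by simp
    with zero_in_SEP[OF card] show ?thesis by simp
  next
    case False
    then have "s > 0"
      unfolding s_def by (intro sum_pos) (auto simp: P_def)
    define w where "w = (\<lambda>(i, j). x $ i * (- x $ j) / s\<^sup>2)"
    define v where "v = (\<lambda>(i::'n, j::'n). axis i (1::real) - axis j 1)"
    have "(\<Sum>p\<in>P \<times> N. w p) = (\<Sum>i\<in>P. x $ i) * (\<Sum>j\<in>N. - x $ j) / s\<^sup>2"
      unfolding w_def sum_product sum.cartesian_product sum_divide_distrib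
      by (intro sum.cong) auto
    then have w1: "(\<Sum>p\<in>P \<times> N. w p) = 1"
      using \<open>s > 0\<close> unfolding sN s_def[symmetric] by (simp add: power2_eq_square)
    have conv: "(\<Sum>p\<in>P \<times> N. w p *\<^sub>R v p) \<in> SEP"
    proof (rule convex_sum[OF _ convex_SEP w1])
      fix p assume p: "p \<in> P \<times> N"
      then show "w p \<ge> 0"
        by (auto simp: w_def P_def N_def intro!: divide_nonpos_nonneg mult_nonneg_nonpos)
      show "v p \<in> SEP"
        using p by (auto simp: v_def P_def N_def intro!: axis_diff_in_SEP)
    qed simp
    \<comment> \<open>\<open>wL\<close> and \<open>wR\<close> are the two marginals of the product
      weights; they collapse the double sum below to single sums.\<close>
    have wL: "(\<Sum>j\<in>N. w (i, j)) = x $ i / s" for i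
    proof -
      have "(\<Sum>j\<in>N. w (i, j)) = x $ i * (\<Sum>j\<in>N. - x $ j) / s\<^sup>2"
        by (simp add: w_def sum_distrib_left sum_divide_distrib)
      then show ?thesis
        using \<open>s > 0\<close> unfolding sN by (simp add: power2_eq_square)
    qed
    have wR: "(\<Sum>i\<in>P. w (i, j)) = - x $ j / s" for j
    proof -
      have "(\<Sum>i\<in>P. w (i, j)) = (\<Sum>i\<in>P. x $ i) * (- x $ j) / s\<^sup>2"
        by (simp add: w_def sum_distrib_right sum_divide_distrib sum_negf)
      then show ?thesis
        using \<open>s > 0\<close> unfolding s_def[symmetric] by (simp add: power2_eq_square)
    qed
    have "(\<Sum>p\<in>P \<times> N. w p *\<^sub>R v p)
        = (\<Sum>i\<in>P. \<Sum>j\<in>N. w (i, j) *\<^sub>R axis i 1) - (\<Sum>i\<in>P. \<Sum>j\<in>N. w (i, j) *\<^sub>R axis j 1)"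
      by (simp add: sum.cartesian_product' v_def scaleR_diff_right sum_subtractf)
    also have "\<dots> = (\<Sum>i\<in>P. (x $ i / s) *\<^sub>R axis i 1) - (\<Sum>j\<in>N. (- x $ j / s) *\<^sub>R axis j 1)"
      unfolding sum.swap[of "\<lambda>i j. w (i, j) *\<^sub>R axis j 1" N P]
      by (simp only: wL wR flip: scaleR_sum_left)
    also have "\<dots> = (1/s) *\<^sub>R x"
      by (subst (3) decomp) (simp add: scaleR_diff_right scaleR_sum_right)
    finally have "(1/s) *\<^sub>R x \<in> SEP"
      using conv by simp
    \<comment> \<open>As \<open>s\<close> is at most 1, \<open>x\<close> lies on the segment from 0
      to \<open>x / s\<close>.\<close>
    then have "(1 - s) *\<^sub>R 0 + s *\<^sub>R ((1/s) *\<^sub>R x) \<in> SEP"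
      using \<open>s > 0\<close> le1
      by (intro convexD[OF convex_SEP zero_in_SEP[OF card]]) (auto simp: s_def P_def)
    then show ?thesis
      using \<open>s > 0\<close> by simp
  qed
qed

subsection \<open>The fixed polytope\<close>

definition invariant_sets :: "('n \<Rightarrow> 'n) \<Rightarrow> 'n set set" where
  "invariant_sets \<sigma> = {S. \<forall>i. \<sigma> i \<in> S \<longleftrightarrow> i \<in> S}"

definition facet_labels :: "('n \<Rightarrow> 'n) \<Rightarrow> 'n set set" where
  "facet_labels \<sigma> = invariant_sets \<sigma> - {{}, UNIV}"

definition fixed_space :: "('n \<Rightarrow> 'n) \<Rightarrow> (real ^ 'n::finite) set" where
  "fixed_space \<sigma> = {x. (\<forall>i. x $ \<sigma> i = x $ i) \<and> (\<Sum>i\<in>UNIV. x $ i) = 0}"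

lemma subspace_fixed_space: "subspace (fixed_space \<sigma>)"
  by (auto simp: subspace_def fixed_space_def sum.distrib simp flip: sum_distrib_left)

lemma fixed_part_SEP_eq:
  fixes \<sigma> :: "'n::finite \<Rightarrow> 'n"
  assumes "\<sigma> permutes UNIV" "CARD('n) \<ge> 2"
  shows "fixed_part \<sigma> SEP =
    fixed_space \<sigma> \<inter> (\<Inter>S\<in>facet_labels \<sigma>. {x. indicator_vec S \<bullet> x \<le> 1})" (is "_ = ?R")
proof
  show "fixed_part \<sigma> SEP \<subseteq> ?R"
    using SEP_sum_le_1 SEP_sum_eq_0
    by (auto simp: fixed_part_def fixed_space_def perm_act_eq_iff[OF assms(1)] inner_indicator_vec)
  show "?R \<subseteq> fixed_part \<sigma> SEP"
  proof
    fix x assume x: "x \<in> ?R"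
    define P where "P = {i. x $ i > 0}"
    have inv: "\<forall>i. x $ \<sigma> i = x $ i" and sum0: "(\<Sum>i\<in>UNIV. x $ i) = 0"
      using x by (auto simp: fixed_space_def)
    have "P \<in> invariant_sets \<sigma>"
      using inv by (simp add: P_def invariant_sets_def)
    moreover have "P \<noteq> UNIV"
    proof
      assume "P = UNIV"
      then have "(\<Sum>i\<in>UNIV. x $ i) > 0"
        by (intro sum_pos) (auto simp: P_def)
      with sum0 show False by simp
    qed
    ultimately have "P = {} \<or> P \<in> facet_labels \<sigma>"
      by (auto simp: facet_labels_def)
    then have "(\<Sum>i\<in>P. x $ i) \<le> 1"
      using x by (auto simp: inner_indicator_vec)
    then show "x \<in> fixed_part \<sigma> SEP"
      using in_SEP_if_sum_pos_le_1[OF assms(2) sum0] inv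
      by (simp add: P_def fixed_part_def perm_act_eq_iff[OF assms(1)])
  qed
qed

text \<open>The fixed polytope contains a small positive multiple of every vector of
  \<open>fixed_space\<close>, so it spans that space. Facets are determined relative to this
  hull.\<close>

lemma affine_hull_fixed_part_SEP:
  fixes \<sigma> :: "'n::finite \<Rightarrow> 'n"
  assumes "\<sigma> permutes UNIV" "CARD('n) \<ge> 2"
  shows "affine hull (fixed_part \<sigma> SEP) = fixed_space \<sigma>"
proof
  let ?Q = "fixed_part \<sigma> SEP"
  show "affine hull ?Q \<subseteq> fixed_space \<sigma>"
    by (rule hull_minimal)
       (auto simp: fixed_part_SEP_eq[OF assms] intro: subspace_imp_affine subspace_fixed_space)
  have 0: "0 \<in> affine hull ?Q"
    by (rule hull_inc)
       (auto simp: fixed_part_SEP_eq[OF assms] subspace_0[OF subspace_fixed_space])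
  show "fixed_space \<sigma> \<subseteq> affine hull ?Q"
  proof
    fix x assume x: "x \<in> fixed_space \<sigma>"
    \<comment> \<open>\<open>r\<close> bounds all subset sums of \<open>x\<close> at once; the
      summand 1 keeps it positive when \<open>x\<close> is 0.\<close>
    define r where "r = 1 + (\<Sum>i\<in>UNIV. \<bar>x $ i\<bar>)"
    have r: "r > 0"
      unfolding r_def by (simp add: add_pos_nonneg sum_nonneg)
    have "(\<Sum>i\<in>S. x $ i) \<le> r" for S
    proof -
      have "(\<Sum>i\<in>S. x $ i) \<le> (\<Sum>i\<in>S. \<bar>x $ i\<bar>)"
        by (intro sum_mono) simp
      also have "\<dots> \<le> (\<Sum>i\<in>UNIV. \<bar>x $ i\<bar>)"
        by (intro sum_mono2) auto
      finally show ?thesis by (simp add: r_def)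
    qed
    then have "(1/r) *\<^sub>R x \<in> ?Q"
      using r x by (auto simp: fixed_part_SEP_eq[OF assms] inner_indicator_vec
          intro: subspace_scale[OF subspace_fixed_space] simp flip: sum_divide_distrib)
    then have "(1 - r) *\<^sub>R 0 + r *\<^sub>R ((1/r) *\<^sub>R x) \<in> affine hull ?Q"
      by (intro mem_affine[OF affine_affine_hull 0] hull_inc) auto
    then show "x \<in> affine hull ?Q"
      using r by simp
  qed
qed

text \<open>The difference of the barycentres of \<open>S\<close> and of its complement lies on the facet labelled \<open>S\<close>
  and strictly satisfies all the other inequalities.\<close>

definition separator :: "'n set \<Rightarrow> real ^ 'n::finite" where
  "separator S = (\<chi> i. if i \<in> S then 1 / card S else - 1 / card (- S))"

lemma sum_separator:
  "(\<Sum>i\<in>T. separator S $ i) = card (T \<inter> S) / card S - card (T - S) / card (- S)"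
  by (simp add: separator_def sum.If_cases Diff_eq)

lemma sum_separator_self: "S \<noteq> {} \<Longrightarrow> (\<Sum>i\<in>S. separator S $ i) = 1"
  by (simp add: sum_separator)

text \<open>If \<open>T\<close> misses an element of \<open>S\<close>, the sum loses at least
  \<open>1 / card S\<close>; otherwise \<open>T\<close> has an element outside \<open>S\<close>,
  which costs at least \<open>1 / card (- S)\<close>. Both losses are at least
  \<open>1 / CARD('n)\<close>, a gap independent of \<open>S\<close> and \<open>T\<close>.\<close>

lemma sum_separator_le:
  fixes S T :: "'n::finite set"
  assumes "S \<noteq> {}" "S \<noteq> UNIV" "T \<noteq> S"
  shows "(\<Sum>i\<in>T. separator S $ i) \<le> 1 - 1 / CARD('n)"
proof -
  have S: "card S > 0" "card (- S) > 0"
    using assms by (auto simp: card_gt_0_iff)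
  have n: "card S \<le> CARD('n)" "card (- S) \<le> CARD('n)"
    by (auto intro: card_mono)
  show ?thesis
  proof (cases "S \<subseteq> T")
    case False
    then have "card (T \<inter> S) < card S"
      by (intro psubset_card_mono) auto
    then have "real (card (T \<inter> S)) / card S \<le> (real (card S) - 1) / card S"
      by (intro divide_right_mono) auto
    also have "\<dots> = 1 - 1 / card S"
      using assms(1) by (simp add: diff_divide_distrib)
    also have "\<dots> \<le> 1 - 1 / CARD('n)"
      using S n by (simp add: frac_le)
    finally show ?thesis
      unfolding sum_separator by (smt (verit) divide_nonneg_nonneg of_nat_0_le_iff)
  next
    case True
    then have "T - S \<noteq> {}" "T \<inter> S = S"
      using assms by auto
    then have "card (T - S) > 0"
      by (simp add: card_gt_0_iff)
    then have "1 / CARD('n) \<le> real (card (T - S)) / card (- S)"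
      using S n by (intro frac_le) auto
    then show ?thesis
      unfolding sum_separator using assms(1) \<open>T \<inter> S = S\<close> by simp
  qed
qed

lemma separator_in_fixed_space:
  assumes "S \<in> facet_labels \<sigma>"
  shows "separator S \<in> fixed_space \<sigma>"
proof -
  have "S \<noteq> {}" "- S \<noteq> {}"
    using assms by (auto simp: facet_labels_def)
  then have "(\<Sum>i\<in>UNIV. separator S $ i) = 0"
    by (simp add: sum_separator flip: Compl_eq_Diff_UNIV)
  then show ?thesis
    using assms
    by (simp add: fixed_space_def separator_def facet_labels_def invariant_sets_def)
qed

text \<open>With n = \<open>CARD('n)\<close>, the dilation factor fits the gap: (1 + 1/n)(1 - 1/n)
  is at most 1, while the inequality of \<open>S\<close>, tight before the dilation, fails after
  it.\<close>

lemma separator_violates_only: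
  fixes S T :: "'n::finite set"
  assumes "S \<noteq> {}" "S \<noteq> UNIV"
  shows "indicator_vec T \<bullet> ((1 + 1 / CARD('n)) *\<^sub>R separator S) \<le> 1 \<longleftrightarrow> T \<noteq> S"
proof (cases "T = S")
  case True
  then show ?thesis
    using sum_separator_self[OF assms(1)] by (simp add: inner_indicator_vec)
next
  case False
  have "(1 + 1 / CARD('n)) * (\<Sum>i\<in>T. separator S $ i) \<le> (1 + 1 / CARD('n)) * (1 - 1 / CARD('n))"
    by (intro mult_left_mono sum_separator_le assms False) auto
  also have "\<dots> \<le> 1"
    by (simp add: algebra_simps)
  finally show ?thesis
    using False by (simp add: inner_indicator_vec)
qed

section \<open>Facets of the fixed polytope and their labels\<close>

lemma facet_of_fixed_part_SEP_iff:
  fixes \<sigma> :: "'n::finite \<Rightarrow> 'n"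
  assumes "\<sigma> permutes UNIV" "CARD('n) \<ge> 2"
  shows "F facet_of fixed_part \<sigma> SEP \<longleftrightarrow>
    (\<exists>S\<in>facet_labels \<sigma>. F = fixed_part \<sigma> SEP \<inter> {x. indicator_vec S \<bullet> x = 1})"
proof -
  let ?Q = "fixed_part \<sigma> SEP"
  let ?L = "facet_labels \<sigma>"
  define h where "h = (\<lambda>S :: 'n set. {x. indicator_vec S \<bullet> x \<le> 1})"
  define p where "p = (\<lambda>S :: 'n set. (1 + 1 / real CARD('n)) *\<^sub>R separator S)"
  have p_iff: "p S \<in> h T \<longleftrightarrow> T \<noteq> S" if "S \<in> ?L" for S T
    using that separator_violates_only[of S T] by (simp add: p_def h_def facet_labels_def)
  have inj: "inj_on h ?L"
    using p_iff by (metis inj_onI)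
  \<comment> \<open>\<open>facet_of_polyhedron_explicit\<close> indexes facets by half-spaces, so
    the normal vector must be recovered from the half-space by inverting \<open>h\<close>.\<close>
  define a where "a = (\<lambda>H. indicator_vec (inv_into ?L h H))"
  have a: "a (h S) = indicator_vec S" if "S \<in> ?L" for S
    using that inj by (simp add: a_def)
  have aff: "affine hull ?Q = fixed_space \<sigma>"
    by (rule affine_hull_fixed_part_SEP[OF assms])
  have Q: "?Q = fixed_space \<sigma> \<inter> \<Inter>(h ` ?L)"
    by (simp add: fixed_part_SEP_eq[OF assms] h_def)
  have "F facet_of ?Q \<longleftrightarrow> (\<exists>H. H \<in> h ` ?L \<and> F = ?Q \<inter> {x. a H \<bullet> x = 1})"
  proof (rule facet_of_polyhedron_explicit)
    show "?Q = affine hull ?Q \<inter> \<Inter>(h ` ?L)"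
      using Q aff by simp
  next
    fix H assume "H \<in> h ` ?L"
    then obtain S where S: "S \<in> ?L" "H = h S" by blast
    then have "S \<noteq> {}"
      by (simp add: facet_labels_def)
    with S show "a H \<noteq> 0 \<and> H = {x. a H \<bullet> x \<le> 1}"
      by (simp add: a indicator_vec_eq_0_iff) (simp add: h_def)
  next
    \<comment> \<open>Irredundancy: \<open>p S\<close>, for a label \<open>S\<close> whose
      half-space is missing from \<open>F'\<close>, satisfies all remaining constraints but is not
      in the polytope.\<close>
    fix F' assume F': "F' \<subset> h ` ?L"
    then obtain S where S: "S \<in> ?L" "h S \<notin> F'" by blast
    have "p S \<in> fixed_space \<sigma>"
      unfolding p_def
      by (intro subspace_scale subspace_fixed_space separator_in_fixed_space S)
    moreover have "p S \<in> H" if "H \<in> F'" for H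
      using that F' S p_iff[OF S(1)] by blast
    moreover have "p S \<notin> ?Q"
      unfolding Q using S p_iff[OF S(1)] by blast
    moreover have "?Q \<subseteq> affine hull ?Q" "?Q \<subseteq> \<Inter>F'"
      using F' by (auto simp: hull_inc Q)
    ultimately show "?Q \<subset> affine hull ?Q \<inter> \<Inter>F'"
      unfolding aff by blast
  qed simp
  then show ?thesis
    by (auto simp: a)
qed

text \<open>The undilated \<open>separator S\<close> belongs to the face labelled \<open>S\<close>
  and to no other one.\<close>

lemma inj_on_fixed_part_facet:
  fixes \<sigma> :: "'n::finite \<Rightarrow> 'n"
  assumes "\<sigma> permutes UNIV" "CARD('n) \<ge> 2"
  shows "inj_on (\<lambda>S. fixed_part \<sigma> SEP \<inter> {x. indicator_vec S \<bullet> x = 1}) (facet_labels \<sigma>)"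
proof (rule inj_onI)
  fix S T
  assume S: "S \<in> facet_labels \<sigma>" and T: "T \<in> facet_labels \<sigma>"
    and eq: "fixed_part \<sigma> SEP \<inter> {x. indicator_vec S \<bullet> x = 1} =
             fixed_part \<sigma> SEP \<inter> {x. indicator_vec T \<bullet> x = 1}"
  have ne: "S \<noteq> {}" "S \<noteq> UNIV"
    using S by (auto simp: facet_labels_def)
  have lt: "(\<Sum>i\<in>R. separator S $ i) < 1" if "R \<noteq> S" for R
    using sum_separator_le[OF ne that] by (rule order.strict_trans1) simp
  have 1: "(\<Sum>i\<in>S. separator S $ i) = 1"
    by (rule sum_separator_self[OF ne(1)])
  have "(\<Sum>i\<in>R. separator S $ i) \<le> 1" for R
    using lt[of R] 1 by (cases "R = S") auto
  then have "separator S \<in> fixed_part \<sigma> SEP"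
    by (simp add: fixed_part_SEP_eq[OF assms] inner_indicator_vec separator_in_fixed_space[OF S])
  with eq 1 have "(\<Sum>i\<in>T. separator S $ i) = 1"
    by (auto simp: inner_indicator_vec)
  with lt[of T] show "S = T" by fastforce
qed

text \<open>For the identity every set is invariant and the fixed polytope is \<open>SEP\<close>
  itself.\<close>

lemma SEP_facet_facet_of:
  fixes S :: "'n::finite set"
  assumes "S \<noteq> {}" "S \<noteq> UNIV" "CARD('n) \<ge> 2"
  shows "SEP_facet S facet_of SEP"
proof -
  have id: "id permutes (UNIV :: 'n set)"
    by (rule permutes_id)
  have "fixed_part id SEP = (SEP :: (real ^ 'n) set)"
    by (simp add: fixed_part_def perm_act_eq_iff[OF id])
  then show ?thesis
    using facet_of_fixed_part_SEP_iff[OF id assms(3), of "SEP_facet S"] assms(1,2)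
    by (auto simp: SEP_facet_def facet_labels_def invariant_sets_def)
qed

subsection \<open>Invariant sets are unions of cycles\<close>

lemma foldr_cycles_apply:
  assumes "distinct (concat cs)" "c \<in> set cs" "i \<in> set c"
  shows "foldr (\<circ>) (map cycle_of_list cs) id i = cycle_of_list c i"
  using assms
proof (induction cs)
  case (Cons d cs)
  have outside: "foldr (\<circ>) (map cycle_of_list es) id j = j"
    if "j \<notin> set (concat es)" for j and es :: "'a list list"
    using that by (induction es) (auto simp: id_outside_supp)
  show ?case
  proof (cases "c \<in> set cs")
    \<comment> \<open>The tail of the product keeps \<open>i\<close> inside \<open>c\<close>, and
      the head cycle \<open>d\<close>, being disjoint from \<open>c\<close>, fixes the result. In
      the other case \<open>c\<close> is the head and the tail fixes \<open>i\<close>.\<close>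
    case True
    then have "cycle_of_list c i \<in> set c"
      using Cons.prems permutes_in_image[OF cycle_permutes] by metis
    then have "cycle_of_list c i \<notin> set d"
      using Cons.prems True by auto
    then show ?thesis
      using Cons True by (simp add: id_outside_supp)
  next
    case False
    then have "i \<notin> set (concat cs)" "c = d"
      using Cons.prems by auto
    moreover have "foldr (\<circ>) (map cycle_of_list (d # cs)) id =
        cycle_of_list d \<circ> foldr (\<circ>) (map cycle_of_list cs) id"
      by simp
    ultimately show ?thesis
      using outside[of i cs] by (metis comp_apply)
  qed
qed simp

text \<open>The powers of a cycle carry any of its elements to any other, and \<open>S\<close> is
  closed under them.\<close>

lemma cycle_subset_if_closed:
  assumes "distinct c" "i \<in> set c" "i \<in> S"
    and closed: "\<And>j. j \<in> set c \<Longrightarrow> j \<in> S \<Longrightarrow> cycle_of_list c j \<in> S"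
  shows "set c \<subseteq> S"
proof -
  have orbit: "(cycle_of_list c ^^ k) i \<in> S \<inter> set c" for k
    by (induction k)
       (use assms permutes_in_image[OF cycle_permutes, of c] in auto)
  obtain a where a: "a < length c" "c ! a = i"
    using assms(2) by (metis in_set_conv_nth)
  have "j \<in> S" if j: "j \<in> set c" for j
  proof -
    obtain b where b: "b < length c" "c ! b = j"
      using j by (metis in_set_conv_nth)
    \<comment> \<open>Moves position \<open>a\<close> to position \<open>b\<close>; adding
      \<open>length c\<close> avoids truncated subtraction when \<open>b < a\<close> and vanishes
      modulo the length.\<close>
    define k where "k = b + (length c - a)"
    \<comment> \<open>By \<open>cyclic_rotation\<close>, mapping the \<open>k\<close>-th power over
      \<open>c\<close> rotates the list by \<open>k\<close>.\<close>
    have "(cycle_of_list c ^^ k) i = rotate k c ! a"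
      using nth_map[OF a(1), of "cycle_of_list c ^^ k"]
      unfolding cyclic_rotation[OF assms(1)] a(2) by (rule sym)
    also have "\<dots> = c ! ((k + a) mod length c)"
      using a(1) by (simp add: nth_rotate add.commute)
    also have "k + a = b + length c"
      using a(1) by (simp add: k_def)
    also have "c ! ((b + length c) mod length c) = j"
      using b by simp
    finally show ?thesis
      using orbit[of k] by simp
  qed
  then show ?thesis by blast
qed

lemma invariant_sets_iff_union_of_cycles:
  assumes "is_cycle_decomposition \<sigma> cs"
  shows "S \<in> invariant_sets \<sigma> \<longleftrightarrow> (\<forall>c\<in>set cs. S \<inter> set c = {} \<or> S \<inter> set c = set c)"
proof -
  have dist: "distinct (concat cs)" and cover: "\<Union>(set ` set cs) = UNIV"
    and \<sigma>: "\<sigma> = foldr (\<circ>) (map cycle_of_list cs) id"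
    using assms by (auto simp: is_cycle_decomposition_def)
  have act: "\<sigma> i = cycle_of_list c i" if "c \<in> set cs" "i \<in> set c" for c i
    unfolding \<sigma> using foldr_cycles_apply[OF dist that] .
  show ?thesis
  proof
    assume S: "S \<in> invariant_sets \<sigma>"
    have "set c \<subseteq> S" if c: "c \<in> set cs" "i \<in> set c" "i \<in> S" for c i
    proof (rule cycle_subset_if_closed[OF _ c(2,3)])
      show "distinct c"
        using dist c(1) by (simp add: distinct_concat_iff)
      show "cycle_of_list c j \<in> S" if "j \<in> set c" "j \<in> S" for j
        using S that(2) unfolding act[OF c(1) that(1), symmetric] by (simp add: invariant_sets_def)
    qed
    then show "\<forall>c\<in>set cs. S \<inter> set c = {} \<or> S \<inter> set c = set c"
      by blast
  next
    assume *: "\<forall>c\<in>set cs. S \<inter> set c = {} \<or> S \<inter> set c = set c"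
    have "\<sigma> i \<in> S \<longleftrightarrow> i \<in> S" for i
    proof -
      obtain c where c: "c \<in> set cs" "i \<in> set c"
        using cover by blast
      then have "\<sigma> i \<in> set c"
        using act permutes_in_image[OF cycle_permutes] by metis
      with c * show ?thesis by blast
    qed
    then show "S \<in> invariant_sets \<sigma>"
      by (simp add: invariant_sets_def)
  qed
qed

section \<open>Counting invariant sets and facet labels\<close>

lemma card_invariant_sets:
  fixes \<sigma> :: "'n::finite \<Rightarrow> 'n"
  assumes "is_cycle_decomposition \<sigma> cs"
  shows "card (invariant_sets \<sigma>) = 2 ^ length cs"
proof -
  have ne: "\<forall>c\<in>set cs. c \<noteq> []" and dist: "distinct (concat cs)"
    and cover: "\<Union>(set ` set cs) = UNIV"
    using assms by (auto simp: is_cycle_decomposition_def)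
  have disj: "c = d" if "c \<in> set cs" "d \<in> set cs" "i \<in> set c" "i \<in> set d" for c d i
    using dist that by (auto simp: distinct_concat_iff)
  \<comment> \<open>Distinctness of \<open>concat cs\<close> does not exclude repeated empty lists,
    hence the appeal to \<open>ne\<close>.\<close>
  have "distinct cs"
    using dist ne by (auto simp: distinct_concat_iff distinct_removeAll)
  have "bij_betw (\<lambda>K. \<Union>(set ` K)) (Pow (set cs)) (invariant_sets \<sigma>)"
  proof (rule bij_betw_byWitness[where f' = "\<lambda>S. {c \<in> set cs. set c \<subseteq> S}"])
    show "\<forall>K\<in>Pow (set cs). {c \<in> set cs. set c \<subseteq> \<Union>(set ` K)} = K"
    proof
      fix K assume K: "K \<in> Pow (set cs)"
      have "c \<in> K" if c: "c \<in> set cs" "set c \<subseteq> \<Union>(set ` K)" for c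
      proof -
        \<comment> \<open>Since cycles are disjoint, one element of \<open>c\<close> identifies the
          member of \<open>K\<close> that covers it.\<close>
        have "hd c \<in> set c" using ne c by simp
        then obtain d where "d \<in> K" "hd c \<in> set d" using c by blast
        with disj[of c d "hd c"] c K \<open>hd c \<in> set c\<close> show ?thesis by blast
      qed
      with K show "{c \<in> set cs. set c \<subseteq> \<Union>(set ` K)} = K" by blast
    qed
    show "\<forall>S\<in>invariant_sets \<sigma>. \<Union>(set ` {c \<in> set cs. set c \<subseteq> S}) = S"
    proof
      fix S assume S: "S \<in> invariant_sets \<sigma>"
      have "i \<in> \<Union>(set ` {c \<in> set cs. set c \<subseteq> S})" if "i \<in> S" for i
      proof -
        obtain c where "c \<in> set cs" "i \<in> set c"
          using cover by blast
        with S that show ?thesis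
          unfolding invariant_sets_iff_union_of_cycles[OF assms] by blast
      qed
      then show "\<Union>(set ` {c \<in> set cs. set c \<subseteq> S}) = S" by blast
    qed
    show "(\<lambda>K. \<Union>(set ` K)) ` Pow (set cs) \<subseteq> invariant_sets \<sigma>"
      unfolding image_subset_iff invariant_sets_iff_union_of_cycles[OF assms]
      using disj by blast
  qed blast
  then have "card (invariant_sets \<sigma>) = card (Pow (set cs))"
    by (simp add: bij_betw_same_card)
  then show ?thesis
    using \<open>distinct cs\<close> by (simp add: card_Pow distinct_card)
qed

lemma card_facet_labels:
  fixes \<sigma> :: "'n::finite \<Rightarrow> 'n"
  assumes "is_cycle_decomposition \<sigma> cs"
  shows "card (facet_labels \<sigma>) = 2 ^ length cs - 2"
proof -
  have "{{}, UNIV} \<subseteq> invariant_sets \<sigma>"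
    by (simp add: invariant_sets_def)
  then show ?thesis
    unfolding facet_labels_def
    by (subst card_Diff_subset) (auto simp: card_invariant_sets[OF assms])
qed

section \<open>Choice of a containing facet of \<open>SEP\<close> for each facet of the fixed
  polytope\<close>

theorem theorem5p7:
  fixes \<sigma> :: "'n::finite \<Rightarrow> 'n" and cs :: "'n list list" and m :: nat
  assumes "\<sigma> permutes UNIV"
    and "is_cycle_decomposition \<sigma> cs"
    and "m = length cs"
  shows "finite {F. F facet_of fixed_part \<sigma> SEP} \<and>
         card {F. F facet_of fixed_part \<sigma> SEP} = 2 ^ m - 2 \<and>
         (\<exists>G. inj_on G {F. F facet_of fixed_part \<sigma> SEP} \<and>
           (\<forall>F. F facet_of fixed_part \<sigma> SEP \<longrightarrow>
              G F facet_of SEP \<and> F \<subseteq> G F \<and>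
              (\<exists>S. S \<noteq> {} \<and> S \<noteq> UNIV \<and> G F = SEP_facet S \<and>
                 (\<forall>k<m. S \<inter> set (cs ! k) = {} \<or> S \<inter> set (cs ! k) = set (cs ! k)))))"
proof (cases "CARD('n) \<ge> 2")
  case False
  then have "CARD('n) = 1"
    using zero_less_card_finite[where 'a = 'n] by linarith
  then obtain a :: 'n where a: "UNIV = {a}"
    by (metis card_1_singletonE)
  then have eq: "i = j" for i j :: 'n
    by (metis UNIV_I singletonD)
  then have "fixed_part \<sigma> SEP = {}"
    by (simp add: fixed_part_def SEP_def)
  \<comment> \<open>The label count now forces \<open>2 ^ m - 2 = 0\<close>, without computing
    \<open>m\<close>.\<close>
  moreover have "facet_labels \<sigma> = {}"
    using eq by (auto simp: facet_labels_def) metis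
  ultimately show ?thesis
    using card_facet_labels[OF assms(2)] assms(3) by simp
next
  case True
  let ?Q = "fixed_part \<sigma> SEP"
  let ?L = "facet_labels \<sigma>"
  define f where "f = (\<lambda>S. ?Q \<inter> {x. indicator_vec S \<bullet> x = 1})"
  define G where "G = (\<lambda>F. SEP_facet (inv_into ?L f F))"
  have facets: "{F. F facet_of ?Q} = f ` ?L"
    using facet_of_fixed_part_SEP_iff[OF assms(1) True] by (auto simp: f_def)
  have inj: "inj_on f ?L"
    unfolding f_def by (rule inj_on_fixed_part_facet[OF assms(1) True])
  have G: "G (f S) = SEP_facet S" if "S \<in> ?L" for S
    using that inj by (simp add: G_def)
  have f: "f S = ?Q \<inter> SEP_facet S" for S
    by (auto simp: f_def SEP_facet_def fixed_part_def)
  \<comment> \<open>Intersecting \<open>SEP_facet S\<close> with the fixed polytope gives back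
    \<open>f S\<close>, so \<open>G\<close> has a left inverse on the facets.\<close>
  have "f S = f T" if "S \<in> ?L" "T \<in> ?L" "G (f S) = G (f T)" for S T
    using that(3) unfolding G[OF that(1)] G[OF that(2)] by (simp add: f)
  then have "inj_on G (f ` ?L)"
    by (auto simp: inj_on_def)
  moreover have "G F facet_of SEP \<and> F \<subseteq> G F \<and>
      (\<exists>S. S \<noteq> {} \<and> S \<noteq> UNIV \<and> G F = SEP_facet S \<and>
        (\<forall>k<m. S \<inter> set (cs ! k) = {} \<or> S \<inter> set (cs ! k) = set (cs ! k)))"
    if F: "F facet_of ?Q" for F
  proof -
    obtain S where S: "S \<in> ?L" "F = f S"
      using F facets by blast
    have ne: "S \<noteq> {}" "S \<noteq> UNIV" and "S \<in> invariant_sets \<sigma>"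
      using S by (auto simp: facet_labels_def)
    then have "\<forall>k<m. S \<inter> set (cs ! k) = {} \<or> S \<inter> set (cs ! k) = set (cs ! k)"
      using assms(3) by (simp add: invariant_sets_iff_union_of_cycles[OF assms(2)])
    moreover have "F \<subseteq> SEP_facet S"
      using S f by blast
    ultimately show ?thesis
      unfolding S(2) G[OF S(1)] using ne SEP_facet_facet_of[OF ne True] by blast
  qed
  moreover have "card (f ` ?L) = 2 ^ m - 2"
    by (simp add: card_image[OF inj] card_facet_labels[OF assms(2)] assms(3))
  ultimately show ?thesis
    unfolding facets by (intro conjI exI[of _ G]) auto
qed

end
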